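(* Let $E$ be a compact Polish space and let $\mathcal{F} \subseteq \mathcal{K}(E)$ be a closed set. The following are equivalent: (1) For every $K \in \mathcal{K}(E)$, if $K$ has nonempty interior in $E$, then $K^* \cap \mathcal{F}$ is nonmeager in $\mathcal{F}$. (2) There exists a set $\mathcal{F}' \subseteq \mathcal{K}(E)$ which is closed and closed upwards, such that for every $K \in \mathcal{K}(E)$: $K^* \cap \mathcal{F}'$ is nonmeager in $\mathcal{F}'$ if and only if $K^* \cap \mathcal{F}$ is nonmeager in $\mathcal{F}$.
   Context: $\mathcal{K}(E)$ denotes the hyperspace of compact subsets of $E$ with the Vietoris topology. For $A \subseteq E$, $A^* = \{K \in \mathcal{K}(E) : K \cap A \neq \emptyset\}$. A set $\mathcal{G} \subseteq \mathcal{K}(E)$ is closed upwards if for all $A, B \in \mathcal{K}(E)$, $A \in \mathcal{G}$ and $A \subseteq B$ imply $B \in \mathcal{G}$. "Meager in $\mathcal{F}$" refers to the relative topology of $\mathcal{F}$ as a subspace of $\mathcal{K}(E)$.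
   Formalization: It is additionally assumed that if E is nonempty then F contains a nonempty compact set; for F = ∅ or F = {∅} over nonempty E the equivalence fails, since (1) fails for K = E while (2) holds with F' = ∅. *)

theory Defs
  imports "HOL-Analysis.Analysis"
begin

(* Topological, not metric: no compatible metric is fixed. *)
definition polish_top :: "'a topology \<Rightarrow> bool" where
  "polish_top X \<longleftrightarrow> completely_metrizable_space X \<and> separable_space X"

(* The empty set is a compact subset and therefore a point of the hyperspace. *)
definition compacts :: "'a topology \<Rightarrow> 'a set set" where
  "compacts E = {K. compactin E K}"

definition hits :: "'a topology \<Rightarrow> 'a set \<Rightarrow> 'a set set" where
  "hits E A = {K \<in> compacts E. K \<inter> A \<noteq> {}}"

definition vietoris :: "'a topology \<Rightarrow> 'a set topology" where
  "vietoris E = topology_generated_by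
     ({{K \<in> compacts E. K \<subseteq> U} | U. openin E U} \<union> {hits E U | U. openin E U})"

lemma topspace_vietoris [simp]: "topspace (vietoris E) = compacts E"
proof -
  have "compacts E = {K \<in> compacts E. K \<subseteq> topspace E}"
    by (auto simp: compacts_def dest: compactin_subset_topspace)
  moreover have "openin E (topspace E)" by simp
  ultimately have "compacts E \<in> {{K \<in> compacts E. K \<subseteq> U} | U. openin E U}"
    by blast
  then show ?thesis
    unfolding vietoris_def topology_generated_by_topspace by (auto simp: hits_def)
qed

definition closed_upwards :: "'a topology \<Rightarrow> 'a set set \<Rightarrow> bool" where
  "closed_upwards E G \<longleftrightarrow>
     (\<forall>A \<in> compacts E. \<forall>B \<in> compacts E. A \<in> G \<and> A \<subseteq> B \<longrightarrow> B \<in> G)"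

definition nowhere_dense_in :: "'a topology \<Rightarrow> 'a set \<Rightarrow> bool" where
  "nowhere_dense_in X S \<longleftrightarrow> S \<subseteq> topspace X \<and> X interior_of (X closure_of S) = {}"

definition meager_in :: "'a topology \<Rightarrow> 'a set \<Rightarrow> bool" where
  "meager_in X S \<longleftrightarrow>
     (\<exists>\<N>. countable \<N> \<and> (\<forall>N \<in> \<N>. nowhere_dense_in X N) \<and> S = \<Union>\<N>)"

end

theory Submission
  imports Defs
begin

text \<open>
  Call \<open>K\<close> small if \<open>K\<^sup>*\<close> is meager in \<open>F\<close>. By the Baire category theorem in the compact Hausdorff
  space \<open>F\<close>, the closed set \<open>K\<close> is not small iff some nonempty relatively open \<open>W\<close> consists of sets
  meeting \<open>K\<close>. If \<open>F'\<close> is nonempty and closed upwards, then it contains \<open>E\<close>, so every \<open>K\<close> with interior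
  is nonmeager for \<open>F'\<close>, which gives (1) from (2).

  Conversely, if \<open>E\<close> has two limit points, choose for each of them a disjoint sequence of regular
  closed sets \<open>S\<close> converging to it, and let \<open>X\<close> be the closure of the union of the even terms. Enumerate
  the pairs of a basic open set \<open>W\<close> of \<open>F\<close> and one of the two limit points as a sequence, and let the
  \<open>m\<close>-th piece of \<open>F'\<close> consist of the sets that contain, up to closure, the trace of a member of \<open>W\<close>
  outside a neighbourhood of the chosen limit point, and that meet both sets \<open>S (2 * m + 1)\<close>. The
  sets meeting both \<open>X\<close> are the limits of these pieces. A neighbourhood avoiding \<open>X\<close> and all
  \<open>S j\<close> with \<open>j \<noteq> 2 * m + 1\<close> at the chosen limit point isolates the \<open>m\<close>-th piece. Two limit points are
  needed because the members of \<open>W\<close> may all be large; smallness is preserved by finite unions, so it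
  can be tested away from one limit point at a time. With at most one limit point, \<open>{E}\<close> or the
  family of all nonempty compact sets works.
\<close>

section \<open>The Vietoris topology: neighbourhoods, separation, compactness, countable
  base\<close>

lemma compacts_eq_closedin:
  assumes "compact_space E" "Hausdorff_space E"
  shows "compacts E = {K. closedin E K}"
  using assms closedin_compact_space compactin_imp_closedin unfolding compacts_def by blast

lemma openin_vietoris_subset:
  "openin E U \<Longrightarrow> openin (vietoris E) {K \<in> compacts E. K \<subseteq> U}"
  unfolding vietoris_def by (rule topology_generated_by_Basis) blast

lemma openin_vietoris_hits:
  "openin E U \<Longrightarrow> openin (vietoris E) (hits E U)"
  unfolding vietoris_def by (rule topology_generated_by_Basis) blast

lemma closedin_vietoris_hits:
  assumes "closedin E L"
  shows "closedin (vietoris E) (hits E L)"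
proof -
  have "compacts E - hits E L = {K \<in> compacts E. K \<subseteq> topspace E - L}"
    by (auto simp: hits_def compacts_def dest: compactin_subset_topspace)
  moreover have "openin (vietoris E) {K \<in> compacts E. K \<subseteq> topspace E - L}"
    using assms by (intro openin_vietoris_subset) auto
  ultimately show ?thesis
    by (auto simp: closedin_def hits_def)
qed

text \<open>Induction along the generation of the topology: containment conditions combine into a
  single \<open>U\<close> by intersection, while hitting conditions accumulate in a finite
  family.\<close>

lemma vietoris_basic_nbhd:
  assumes "openin (vietoris E) W" "B \<in> W"
  obtains U \<V> where "openin E U" "finite \<V>" "\<And>V. V \<in> \<V> \<Longrightarrow> openin E V" "B \<subseteq> U"
    "\<And>V. V \<in> \<V> \<Longrightarrow> B \<inter> V \<noteq> {}"
    "\<And>C. \<lbrakk>C \<in> compacts E; C \<subseteq> U; \<And>V. V \<in> \<V> \<Longrightarrow> C \<inter> V \<noteq> {}\<rbrakk> \<Longrightarrow> C \<in> W"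
proof -
  define good where "good W B \<longleftrightarrow> (\<exists>U \<V>. openin E U \<and> finite \<V> \<and> (\<forall>V\<in>\<V>. openin E V) \<and> B \<subseteq> U \<and>
     (\<forall>V\<in>\<V>. B \<inter> V \<noteq> {}) \<and> (\<forall>C\<in>compacts E. C \<subseteq> U \<and> (\<forall>V\<in>\<V>. C \<inter> V \<noteq> {}) \<longrightarrow> C \<in> W))" for W B
  have "generate_topology_on
     ({{K \<in> compacts E. K \<subseteq> U} | U. openin E U} \<union> {hits E U | U. openin E U}) W"
    using assms(1) unfolding vietoris_def by (rule openin_topology_generated_by)
  then have "\<forall>B\<in>W. good W B"
  proof (induction rule: generate_topology_on.induct)
    case Empty
    then show ?case by simp
  next
    case (Int a b)
    show ?case
    proof
      fix B assume "B \<in> a \<inter> b"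
      then have "good a B" "good b B" using Int.IH by blast+
      then obtain U \<V> U' \<V>' where
        1: "openin E U" "finite \<V>" "\<forall>V\<in>\<V>. openin E V" "B \<subseteq> U" "\<forall>V\<in>\<V>. B \<inter> V \<noteq> {}"
          "\<forall>C\<in>compacts E. C \<subseteq> U \<and> (\<forall>V\<in>\<V>. C \<inter> V \<noteq> {}) \<longrightarrow> C \<in> a" and
        2: "openin E U'" "finite \<V>'" "\<forall>V\<in>\<V>'. openin E V" "B \<subseteq> U'" "\<forall>V\<in>\<V>'. B \<inter> V \<noteq> {}"
          "\<forall>C\<in>compacts E. C \<subseteq> U' \<and> (\<forall>V\<in>\<V>'. C \<inter> V \<noteq> {}) \<longrightarrow> C \<in> b"
        unfolding good_def by (elim exE conjE) (rule that)
      show "good (a \<inter> b) B"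
        unfolding good_def
        by (rule exI[of _ "U \<inter> U'"], rule exI[of _ "\<V> \<union> \<V>'"]) (use 1 2 in auto)
    qed
  next
    case (UN \<K>)
    show ?case
    proof
      fix B assume "B \<in> \<Union>\<K>"
      then obtain a where a: "a \<in> \<K>" "B \<in> a" by blast
      then have "good a B" using UN.IH by blast
      moreover have "good a B \<Longrightarrow> good (\<Union>\<K>) B"
        unfolding good_def using a(1) by (elim ex_forward conj_forward) auto
      ultimately show "good (\<Union>\<K>) B" by blast
    qed
  next
    case (Basis s)
    then consider U where "openin E U" "s = {K \<in> compacts E. K \<subseteq> U}"
      | V where "openin E V" "s = hits E V" by blast
    then show ?case
    proof cases
      case 1
      then have "good s B" if "B \<in> s" for B
        unfolding good_def using that by (intro exI[of _ U] exI[of _ "{}"]) auto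
      then show ?thesis by blast
    next
      case 2
      then have "good s B" if "B \<in> s" for B
        unfolding good_def using that
        by (intro exI[of _ "topspace E"] exI[of _ "{V}"])
           (auto simp: hits_def compacts_def dest: compactin_subset_topspace)
      then show ?thesis by blast
    qed
  qed
  then have "good W B" using assms by blast
  then obtain U \<V> where "openin E U" "finite \<V>" "\<forall>V\<in>\<V>. openin E V" "B \<subseteq> U"
    "\<forall>V\<in>\<V>. B \<inter> V \<noteq> {}" "\<forall>C\<in>compacts E. C \<subseteq> U \<and> (\<forall>V\<in>\<V>. C \<inter> V \<noteq> {}) \<longrightarrow> C \<in> W"
    unfolding good_def by (elim exE conjE) (rule that)
  then show thesis by (intro that[of U \<V>]) auto
qed

text \<open>A point of \<open>A\<close> outside \<open>B\<close> is separated from the compact set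
  \<open>B\<close> by disjoint open sets; hitting the one and being contained in the other are
  incompatible.\<close>

lemma Hausdorff_space_vietoris:
  assumes "Hausdorff_space E"
  shows "Hausdorff_space (vietoris E)"
proof -
  have *: "\<exists>U V. openin (vietoris E) U \<and> openin (vietoris E) V \<and> A \<in> U \<and> B \<in> V \<and> disjnt U V"
    if A: "A \<in> compacts E" and B: "B \<in> compacts E" and x: "x \<in> A" "x \<notin> B" for A B x
  proof -
    have "compactin E {x}"
      using A x by (auto simp: compacts_def dest: compactin_subset_topspace)
    moreover have "compactin E B" using B by (simp add: compacts_def)
    moreover have "disjnt {x} B" using x by simp
    ultimately obtain U V where UV: "openin E U" "openin E V" "{x} \<subseteq> U" "B \<subseteq> V" "disjnt U V"
      using Hausdorff_space_compact_separation[OF assms] by blast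
    have "A \<in> hits E U" "B \<in> {K \<in> compacts E. K \<subseteq> V}" "disjnt (hits E U) {K \<in> compacts E. K \<subseteq> V}"
      using A B x UV by (auto simp: hits_def disjnt_def)
    then show ?thesis
      using openin_vietoris_hits[OF UV(1)] openin_vietoris_subset[OF UV(2)] by blast
  qed
  show ?thesis
    unfolding Hausdorff_space_def topspace_vietoris
  proof (intro allI impI)
    fix A B assume h: "A \<in> compacts E \<and> B \<in> compacts E \<and> A \<noteq> B"
    then consider x where "x \<in> A" "x \<notin> B" | x where "x \<in> B" "x \<notin> A" by blast
    then show "\<exists>U V. openin (vietoris E) U \<and> openin (vietoris E) V \<and> A \<in> U \<and> B \<in> V \<and> disjnt U V"
      using * h by cases (blast, metis disjnt_sym)
  qed
qed

text \<open>Brings the generated topology into the form to which \<open>Alexander_subbase\<close>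
  applies.\<close>

lemma topology_generated_by_eq_subbase:
  "topology_generated_by \<B> =
    topology (arbitrary union_of (finite intersection_of (\<lambda>x. x \<in> \<B>) relative_to \<Union>\<B>))"
    (is "_ = ?T")
proof -
  have "openin (topology_generated_by \<B>) S \<longleftrightarrow> openin ?T S" (is "?L \<longleftrightarrow> ?R") for S
  proof
    assume ?L
    have "openin ?T s" if "s \<in> \<B>" for s
    proof -
      have "s = \<Union>\<B> \<inter> s" using that by blast
      then have "(finite intersection_of (\<lambda>x. x \<in> \<B>) relative_to \<Union>\<B>) s"
        unfolding relative_to_def using finite_intersection_of_inc[of "\<lambda>x. x \<in> \<B>", OF that] by blast
      then show ?thesis
        unfolding openin_subbase by (rule arbitrary_union_of_inc)
    qed
    then show ?R
      using \<open>?L\<close> unfolding openin_topology_generated_by_iff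
      by (rule generate_topology_on_coarsest[OF istopology_openin])
  next
    assume ?R
    have "openin (topology_generated_by \<B>) s"
      if "(finite intersection_of (\<lambda>x. x \<in> \<B>) relative_to \<Union>\<B>) s" for s
    proof -
      from that obtain t where t: "(finite intersection_of (\<lambda>x. x \<in> \<B>)) t" "s = \<Union>\<B> \<inter> t"
        unfolding relative_to_def by blast
      then obtain \<F> where \<F>: "finite \<F>" "\<F> \<subseteq> \<B>" "t = \<Inter>\<F>"
        unfolding intersection_of_def by auto
      have "openin (topology_generated_by \<B>) (topspace (topology_generated_by \<B>) \<inter> \<Inter>\<F>)"
        using \<F> by (intro openin_Int_Inter) (auto intro: topology_generated_by_Basis)
      then show ?thesis using t \<F> by (simp add: topology_generated_by_topspace)
    qed
    moreover obtain \<U> where "S = \<Union>\<U>"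
      "\<And>s. s \<in> \<U> \<Longrightarrow> (finite intersection_of (\<lambda>x. x \<in> \<B>) relative_to \<Union>\<B>) s"
      using \<open>?R\<close> unfolding openin_subbase unfolding union_of_def by auto
    ultimately show ?L by auto
  qed
  then show ?thesis by (simp add: topology_eq)
qed

lemma compact_space_vietoris:
  assumes E: "compact_space E"
  shows "compact_space (vietoris E)"
proof -
  let ?\<B> = "{{K \<in> compacts E. K \<subseteq> U} | U. openin E U} \<union> {hits E U | U. openin E U}"
  show ?thesis
  proof (rule Alexander_subbase)
    show "topology (arbitrary union_of (finite intersection_of (\<lambda>x. x \<in> ?\<B>) relative_to \<Union>?\<B>)) = vietoris E"
      unfolding vietoris_def by (rule topology_generated_by_eq_subbase[symmetric])
  next
    fix \<C> assume sub: "\<C> \<subseteq> ?\<B>" and cov: "\<Union>\<C> = topspace (vietoris E)"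
    define \<V> where "\<V> = {V. openin E V \<and> hits E V \<in> \<C>}"
    \<comment> \<open>\<open>K0\<close> escapes every hitting member of the cover, so it lies in a
      containment member given by some \<open>U\<close>; the compact complement of \<open>U\<close>
      is then covered by finitely many sets of \<open>\<V>\<close>.\<close>
    define K0 where "K0 = topspace E - \<Union>\<V>"
    have "openin E (\<Union>\<V>)" by (auto simp: \<V>_def)
    then have "closedin E K0" unfolding K0_def by (rule openin_closedin_eq[THEN iffD1, THEN conjunct2])
    then have K0: "K0 \<in> compacts E"
      using E by (simp add: compacts_def closedin_compact_space)
    then obtain s where s: "s \<in> \<C>" "K0 \<in> s" using cov by auto
    have "\<not> (\<exists>V. openin E V \<and> s = hits E V)"
    proof
      assume "\<exists>V. openin E V \<and> s = hits E V"
      then obtain V where "V \<in> \<V>" "K0 \<inter> V \<noteq> {}" using s by (auto simp: \<V>_def hits_def)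
      then show False by (auto simp: K0_def)
    qed
    moreover have "s \<in> ?\<B>" using s(1) sub by (rule subsetD[rotated])
    ultimately obtain U where U: "openin E U" "s = {K \<in> compacts E. K \<subseteq> U}" by auto
    have "K0 \<subseteq> U" using s U by blast
    have "compactin E (topspace E - U)"
      using E U(1) by (simp add: closedin_compact_space closedin_diff)
    moreover have "topspace E - U \<subseteq> \<Union>\<V>" using \<open>K0 \<subseteq> U\<close> by (auto simp: K0_def)
    moreover have "\<forall>V\<in>\<V>. openin E V" by (simp add: \<V>_def)
    ultimately obtain \<F> where \<F>: "finite \<F>" "\<F> \<subseteq> \<V>" "topspace E - U \<subseteq> \<Union>\<F>"
      unfolding compactin_def by meson
    have "K \<in> \<Union>(insert s (hits E ` \<F>))" if "K \<in> compacts E" for K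
    proof (cases "K \<subseteq> U")
      case True then show ?thesis using that U by blast
    next
      case False
      then obtain x where "x \<in> K" "x \<notin> U" by blast
      moreover have "K \<subseteq> topspace E"
        using that by (simp add: compacts_def compactin_subset_topspace)
      ultimately obtain V where "V \<in> \<F>" "x \<in> V" using \<F>(3) by blast
      then show ?thesis using \<open>x \<in> K\<close> that by (auto simp: hits_def)
    qed
    moreover have "insert s (hits E ` \<F>) \<subseteq> \<C>" using s \<F> by (auto simp: \<V>_def)
    moreover have "finite (insert s (hits E ` \<F>))" using \<F> by simp
    ultimately show "\<exists>C'. finite C' \<and> C' \<subseteq> \<C> \<and> \<Union>C' = topspace (vietoris E)"
      using cov unfolding topspace_vietoris by (metis Union_mono subset_antisym subsetI)
  qed
qed

lemma separable_metrizable_imp_second_countable: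
  assumes "metrizable_space X" "separable_space X"
  shows "second_countable X"
proof -
  obtain M d where "Metric_space M d" and X: "X = Metric_space.mtopology M d"
    using assms(1) unfolding metrizable_space_def by blast
  then interpret Metric_space M d by simp
  obtain D where D: "countable D" "D \<subseteq> M" "mtopology closure_of D = M"
    using assms(2) X unfolding separable_space_def by auto
  let ?\<B> = "(\<lambda>(x, n). mball x (inverse (Suc n))) ` (D \<times> (UNIV::nat set))"
  have "\<exists>V\<in>?\<B>. x \<in> V \<and> V \<subseteq> U" if U: "openin mtopology U" "x \<in> U" for U x
  proof -
    obtain r where r: "r > 0" "mball x r \<subseteq> U" and "x \<in> M"
      using U unfolding openin_mtopology by blast
    obtain n where n: "inverse (real (Suc n)) < r / 2"
      using r reals_Archimedean[of "r/2"] by auto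
    have "x \<in> mtopology closure_of D" using D \<open>x \<in> M\<close> by simp
    then obtain y where y: "y \<in> D" "y \<in> mball x (inverse (Suc n))"
      unfolding metric_closure_of by (auto simp del: of_nat_Suc dest!: spec[of _ "inverse (real (Suc n))"])
    have "x \<in> mball y (inverse (Suc n))" using y \<open>x \<in> M\<close> by (auto simp: commute)
    moreover have "mball y (inverse (Suc n)) \<subseteq> mball x r"
    proof
      fix z assume z: "z \<in> mball y (inverse (Suc n))"
      then have "d x z \<le> d x y + d y z" using y \<open>x \<in> M\<close> by (auto intro: triangle)
      also have "\<dots> < r" using z y n by (simp del: of_nat_Suc)
      finally show "z \<in> mball x r" using z \<open>x \<in> M\<close> by auto
    qed
    ultimately show ?thesis using r y by (intro bexI[of _ "mball y (inverse (Suc n))"]) auto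
  qed
  moreover have "countable ?\<B>" using D by auto
  moreover have "\<forall>V\<in>?\<B>. openin mtopology V" by auto
  ultimately show ?thesis unfolding second_countable_def X by blast
qed

lemma second_countable_vietoris:
  assumes E: "second_countable E"
  shows "second_countable (vietoris E)"
proof -
  obtain \<B> where \<B>: "countable \<B>" "\<And>V. V \<in> \<B> \<Longrightarrow> openin E V"
    "\<And>U x. \<lbrakk>openin E U; x \<in> U\<rbrakk> \<Longrightarrow> \<exists>V\<in>\<B>. x \<in> V \<and> V \<subseteq> U"
    using E unfolding second_countable_def by auto
  let ?fin = "{\<U>. finite \<U> \<and> \<U> \<subseteq> \<B>}"
  \<comment> \<open>By compactness, finite unions of basic open sets suffice in the containment
    condition, which keeps the family countable. The factor \<open>compacts E\<close> keeps the
    second part open when \<open>\<V>\<close> is empty.\<close>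
  define N where "N = (\<lambda>(\<U>, \<V>). {K \<in> compacts E. K \<subseteq> \<Union>\<U>} \<inter> (compacts E \<inter> \<Inter>(hits E ` \<V>)))"
  have "countable (N ` (?fin \<times> ?fin))"
    using \<B>(1) by (intro countable_image countable_SIGMA countable_Collect_finite_subset)
  moreover have "openin (vietoris E) (N (\<U>, \<V>))" if "\<U> \<in> ?fin" "\<V> \<in> ?fin" for \<U> \<V>
  proof -
    have "openin (vietoris E) (topspace (vietoris E) \<inter> \<Inter>(hits E ` \<V>))"
      using that \<B>(2) by (intro openin_Int_Inter openin_topspace) (auto intro!: openin_vietoris_hits)
    moreover have "openin (vietoris E) {K \<in> compacts E. K \<subseteq> \<Union>\<U>}"
      using that \<B>(2) by (intro openin_vietoris_subset) auto
    ultimately show ?thesis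
      unfolding N_def by (simp add: openin_Int)
  qed
  moreover have "\<exists>V\<in>N ` (?fin \<times> ?fin). B \<in> V \<and> V \<subseteq> W"
    if W: "openin (vietoris E) W" "B \<in> W" for W B
  proof -
    have B: "B \<in> compacts E" using W openin_subset by fastforce
    obtain U \<V> where U: "openin E U" "finite \<V>" "\<And>V. V \<in> \<V> \<Longrightarrow> openin E V" "B \<subseteq> U"
      "\<And>V. V \<in> \<V> \<Longrightarrow> B \<inter> V \<noteq> {}"
      "\<And>C. \<lbrakk>C \<in> compacts E; C \<subseteq> U; \<And>V. V \<in> \<V> \<Longrightarrow> C \<inter> V \<noteq> {}\<rbrakk> \<Longrightarrow> C \<in> W"
      using vietoris_basic_nbhd[OF W] by blast
    have "\<exists>b\<in>\<B>. B \<inter> b \<noteq> {} \<and> b \<subseteq> V" if V: "V \<in> \<V>" for V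
    proof -
      obtain x where "x \<in> B" "x \<in> V" using U(5)[OF V] by blast
      then show ?thesis using \<B>(3)[OF U(3)[OF V]] by blast
    qed
    then obtain b where b: "\<And>V. V \<in> \<V> \<Longrightarrow> b V \<in> \<B> \<and> B \<inter> b V \<noteq> {} \<and> b V \<subseteq> V" by metis
    have "B \<subseteq> \<Union>{b \<in> \<B>. b \<subseteq> U}" using U(1,4) \<B>(3) by blast
    moreover have "compactin E B" using B by (simp add: compacts_def)
    ultimately obtain \<U> where \<U>: "finite \<U>" "\<U> \<subseteq> {b \<in> \<B>. b \<subseteq> U}" "B \<subseteq> \<Union>\<U>"
      unfolding compactin_def using \<B>(2) by (metis (no_types, lifting) mem_Collect_eq)
    have "(\<U>, b ` \<V>) \<in> ?fin \<times> ?fin" using \<U> b U(2) by auto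
    moreover have "B \<in> N (\<U>, b ` \<V>)" using B \<U> b by (auto simp: N_def hits_def)
    moreover have "N (\<U>, b ` \<V>) \<subseteq> W"
    proof
      fix C assume C: "C \<in> N (\<U>, b ` \<V>)"
      show "C \<in> W"
      proof (rule U(6))
        have "\<Union>\<U> \<subseteq> U" using \<U>(2) by blast
        then show "C \<in> compacts E" "C \<subseteq> U" using C by (auto simp: N_def)
        show "C \<inter> V \<noteq> {}" if "V \<in> \<V>" for V
          using C b[OF that] that by (fastforce simp: N_def hits_def)
      qed
    qed
    ultimately show ?thesis by blast
  qed
  ultimately show ?thesis
    unfolding second_countable_def by (intro exI[of _ "N ` (?fin \<times> ?fin)"]) auto
qed

section \<open>Meager sets, and when \<open>hits E K\<close> is nonmeager in a closed family\<close>

lemma meager_in_subset: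
  assumes "meager_in X S" "T \<subseteq> S"
  shows "meager_in X T"
proof -
  obtain \<N> where \<N>: "countable \<N>" "\<forall>N\<in>\<N>. nowhere_dense_in X N" "S = \<Union>\<N>"
    using assms(1) unfolding meager_in_def by blast
  have "nowhere_dense_in X (N \<inter> T)" if "N \<in> \<N>" for N
  proof -
    have "X interior_of (X closure_of (N \<inter> T)) \<subseteq> X interior_of (X closure_of N)"
      by (intro interior_of_mono closure_of_mono) blast
    then show ?thesis using \<N>(2) that unfolding nowhere_dense_in_def by blast
  qed
  moreover have "countable ((\<lambda>N. N \<inter> T) ` \<N>)" "T = \<Union>((\<lambda>N. N \<inter> T) ` \<N>)"
    using \<N> assms(2) by auto
  ultimately show ?thesis unfolding meager_in_def by blast
qed

lemma meager_in_Un: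
  assumes "meager_in X S" "meager_in X T"
  shows "meager_in X (S \<union> T)"
proof -
  obtain \<M> \<N> where "countable \<M>" "\<forall>N\<in>\<M>. nowhere_dense_in X N" "S = \<Union>\<M>"
    "countable \<N>" "\<forall>N\<in>\<N>. nowhere_dense_in X N" "T = \<Union>\<N>"
    using assms unfolding meager_in_def by blast
  then show ?thesis
    unfolding meager_in_def by (intro exI[of _ "\<M> \<union> \<N>"]) auto
qed

text \<open>One direction is Baire category applied to the closures of the nowhere dense pieces; for
  the other, a closed set without interior is itself nowhere dense.\<close>

lemma not_meager_in_closedin_iff:
  assumes X: "compact_space X" "Hausdorff_space X" and S: "closedin X S"
  shows "\<not> meager_in X S \<longleftrightarrow> X interior_of S \<noteq> {}"
proof
  assume "\<not> meager_in X S"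
  moreover have "nowhere_dense_in X S" if "X interior_of S = {}"
    using that S closedin_subset by (auto simp: nowhere_dense_in_def closure_of_closedin)
  then have "meager_in X S" if "X interior_of S = {}"
    using that unfolding meager_in_def by (intro exI[of _ "{S}"]) auto
  ultimately show "X interior_of S \<noteq> {}" by blast
next
  assume ne: "X interior_of S \<noteq> {}"
  show "\<not> meager_in X S"
  proof
    assume "meager_in X S"
    then obtain \<N> where \<N>: "countable \<N>" "\<forall>N\<in>\<N>. nowhere_dense_in X N" "S = \<Union>\<N>"
      unfolding meager_in_def by blast
    have "X interior_of \<Union>((closure_of) X ` \<N>) = {}"
      using X \<N> by (intro Baire_category_alt)
        (auto simp: nowhere_dense_in_def compact_imp_locally_compact_space
          compact_Hausdorff_imp_regular_space)
    moreover have "S \<subseteq> \<Union>((closure_of) X ` \<N>)"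
      using \<N> closure_of_subset unfolding nowhere_dense_in_def by fastforce
    ultimately show False using ne interior_of_mono by blast
  qed
qed

text \<open>The subspace \<open>F\<close> inherits compactness and the Hausdorff property, so the
  category condition reduces to finding one relatively open set inside the closed set
  \<open>hits E K\<close>.\<close>

lemma nonmeager_hits_iff:
  assumes E: "compact_space E" "Hausdorff_space E"
    and F: "closedin (vietoris E) F" and K: "closedin E K"
  shows "\<not> meager_in (subtopology (vietoris E) F) (hits E K \<inter> F) \<longleftrightarrow>
    (\<exists>W. openin (vietoris E) W \<and> W \<inter> F \<noteq> {} \<and> W \<inter> F \<subseteq> hits E K)"
proof -
  let ?X = "subtopology (vietoris E) F"
  have "compact_space ?X"
    using E F by (intro compact_space_subtopology closedin_compact_space compact_space_vietoris)
  moreover have "Hausdorff_space ?X"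
    using E by (intro Hausdorff_space_subtopology Hausdorff_space_vietoris)
  moreover have "closedin ?X (hits E K \<inter> F)"
    using closedin_vietoris_hits[OF K] unfolding closedin_subtopology by blast
  ultimately have "\<not> meager_in ?X (hits E K \<inter> F) \<longleftrightarrow> ?X interior_of (hits E K \<inter> F) \<noteq> {}"
    by (rule not_meager_in_closedin_iff)
  also have "\<dots> \<longleftrightarrow> (\<exists>W. openin (vietoris E) W \<and> W \<inter> F \<noteq> {} \<and> W \<inter> F \<subseteq> hits E K)"
    unfolding interior_of_eq_empty openin_subtopology by auto
  finally show ?thesis .
qed

lemma closed_upwards_mono:
  "\<lbrakk>closed_upwards E F; A \<in> F; A \<in> compacts E; A \<subseteq> B; B \<in> compacts E\<rbrakk> \<Longrightarrow> B \<in> F"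
  unfolding closed_upwards_def by blast

text \<open>Upward closure puts the whole space into \<open>F\<close>, and the whole space belongs
  to the open family of sets hitting the interior of \<open>K\<close>.\<close>

lemma nonmeager_hits_if_interior:
  assumes E: "compact_space E" "Hausdorff_space E"
    and F: "closedin (vietoris E) F" and up: "closed_upwards E F" and "F \<noteq> {}"
    and K: "closedin E K" "E interior_of K \<noteq> {}"
  shows "\<not> meager_in (subtopology (vietoris E) F) (hits E K \<inter> F)"
proof -
  obtain A where A: "A \<in> F" "A \<in> compacts E"
    using \<open>F \<noteq> {}\<close> closedin_subset[OF F] by auto
  have top: "topspace E \<in> compacts E"
    using E by (simp add: compacts_def compact_space_def)
  have "A \<subseteq> topspace E"
    using A by (simp add: compacts_def compactin_subset_topspace)
  then have "topspace E \<in> F" using closed_upwards_mono[OF up A] top by blast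
  moreover have "topspace E \<in> hits E (E interior_of K)"
    using K top interior_of_subset_topspace[of E K] by (auto simp: hits_def)
  moreover have "hits E (E interior_of K) \<subseteq> hits E K"
    using interior_of_subset[of E K] by (auto simp: hits_def)
  moreover have "openin (vietoris E) (hits E (E interior_of K))"
    by (simp add: openin_vietoris_hits)
  ultimately show ?thesis
    unfolding nonmeager_hits_iff[OF E F K(1)]
    by (intro exI[of _ "hits E (E interior_of K)"]) auto
qed

text \<open>For an upward closed family the conditions \<open>C \<inter> V \<noteq> {}\<close> of a basic Vietoris neighbourhood
  can be met by adding finitely many points outside the nowhere dense set \<open>K\<close>, so only the
  condition \<open>C \<subseteq> U\<close> matters.\<close>
lemma nonmeager_hits_closed_upwards_iff:
  assumes E: "compact_space E" "Hausdorff_space E"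
    and F: "closedin (vietoris E) F" and up: "closed_upwards E F"
    and K: "closedin E K" "E interior_of K = {}"
  shows "\<not> meager_in (subtopology (vietoris E) F) (hits E K \<inter> F) \<longleftrightarrow>
    (\<exists>U. openin E U \<and> (\<exists>C\<in>F. C \<subseteq> U) \<and> (\<forall>C\<in>F. C \<subseteq> U \<longrightarrow> C \<inter> K \<noteq> {}))" (is "?L \<longleftrightarrow> ?R")
proof
  assume ?L
  then obtain W where W: "openin (vietoris E) W" "W \<inter> F \<noteq> {}" "W \<inter> F \<subseteq> hits E K"
    unfolding nonmeager_hits_iff[OF E F K(1)] by blast
  then obtain B where B: "B \<in> W" "B \<in> F" by blast
  obtain U \<V> where U: "openin E U" "finite \<V>" "\<And>V. V \<in> \<V> \<Longrightarrow> openin E V" "B \<subseteq> U"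
      "\<And>V. V \<in> \<V> \<Longrightarrow> B \<inter> V \<noteq> {}"
      "\<And>C. \<lbrakk>C \<in> compacts E; C \<subseteq> U; \<And>V. V \<in> \<V> \<Longrightarrow> C \<inter> V \<noteq> {}\<rbrakk> \<Longrightarrow> C \<in> W"
    using vietoris_basic_nbhd[OF W(1) B(1)] by blast
  have "\<exists>z. z \<in> V \<inter> U - K" if V: "V \<in> \<V>" for V
  proof -
    have "openin E (V \<inter> U)" "V \<inter> U \<noteq> {}"
      using U(1,4) U(3,5)[OF V] by (auto simp: openin_Int)
    then show ?thesis using K(2) unfolding interior_of_eq_empty by blast
  qed
  then obtain z where z: "\<And>V. V \<in> \<V> \<Longrightarrow> z V \<in> V \<inter> U - K" by metis
  have "C \<inter> K \<noteq> {}" if C: "C \<in> F" "C \<subseteq> U" for C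
  proof -
    have cC: "C \<in> compacts E" using C(1) closedin_subset[OF F] by auto
    have "z ` \<V> \<subseteq> topspace E" using z openin_subset[OF U(1)] by blast
    then have cD: "C \<union> z ` \<V> \<in> compacts E"
      using cC U(2) by (auto simp: compacts_def intro: compactin_Un finite_imp_compactin)
    have "C \<union> z ` \<V> \<in> W" by (rule U(6)) (use cD C z in auto)
    moreover have "C \<union> z ` \<V> \<in> F" using closed_upwards_mono[OF up C(1) cC _ cD] by blast
    ultimately have "(C \<union> z ` \<V>) \<inter> K \<noteq> {}" using W(3) by (auto simp: hits_def)
    then show ?thesis using z by blast
  qed
  then show ?R using U(1,4) B(2) by blast
next
  assume ?R
  then obtain U where U: "openin E U" "\<exists>C\<in>F. C \<subseteq> U" "\<forall>C\<in>F. C \<subseteq> U \<longrightarrow> C \<inter> K \<noteq> {}" by blast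
  have "F \<subseteq> compacts E" using closedin_subset[OF F] by simp
  then show ?L
    unfolding nonmeager_hits_iff[OF E F K(1)]
    using U openin_vietoris_subset[OF U(1)]
    by (intro exI[of _ "{K \<in> compacts E. K \<subseteq> U}"]) (auto simp: hits_def)
qed

section \<open>Shells around a limit point and hulls of traces\<close>

text \<open>The sets are closures of open annuli around \<open>x\<close>, at radii that are attained
  by points and shrink fast enough to keep the annuli apart. Closures of open sets are regular
  closed.\<close>

lemma shells_converging_to_limit_point:
  assumes "metrizable_space E" "x \<in> topspace E" "\<not> openin E {x}" "openin E N" "x \<in> N"
  obtains S :: "nat \<Rightarrow> 'a set" where
    "\<And>n. closedin E (S n)" "\<And>n. S n \<subseteq> N" "\<And>n. x \<notin> S n" "\<And>n. S n \<noteq> {}"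
    "\<And>n. S n \<subseteq> E closure_of (E interior_of S n)"
    "\<And>m n. m \<noteq> n \<Longrightarrow> S m \<inter> S n = {}"
    "\<And>V. \<lbrakk>openin E V; x \<in> V\<rbrakk> \<Longrightarrow> \<exists>n. \<forall>m\<ge>n. S m \<subseteq> V"
proof -
  obtain M d where "Metric_space M d" and E: "E = Metric_space.mtopology M d"
    using assms(1) unfolding metrizable_space_def by blast
  then interpret Metric_space M d by simp
  have x: "x \<in> M" using assms(2) E by simp
  obtain e where e: "e > 0" "mball x e \<subseteq> N"
    using assms(4,5) unfolding E openin_mtopology by blast
  have near: "\<exists>y\<in>M. 0 < d x y \<and> d x y < r" if r: "r > 0" for r
  proof (rule ccontr)
    assume "\<not> ?thesis"
    then have "mball x r = {x}"
      using x r by (auto simp: mdist_pos_less)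
    then show False using assms(3) E openin_mball by metis
  qed
  \<comment> \<open>The bound \<open>2 * r < e\<close> keeps the annulus with outer radius
    \<open>2 * r\<close> inside \<open>N\<close>; a point at distance exactly \<open>r\<close> makes
    it nonempty.\<close>
  let ?P = "\<lambda>(n::nat) r. 0 < r \<and> 2 * r < e \<and> (\<exists>y\<in>M. d x y = r)"
  have "\<exists>s. \<forall>n. ?P n (s n) \<and> s (Suc n) < s n / 5"
  proof (rule dependent_nat_choice)
    show "\<exists>r. ?P 0 r" using near[of "e / 2"] e by auto
    show "\<exists>r'. ?P (Suc n) r' \<and> r' < r / 5" if r: "?P n r" for r n
      using near[of "r / 5"] r by auto
  qed
  then obtain s where s: "\<And>n. 0 < s n" "\<And>n. 2 * s n < e" "\<And>n. \<exists>y\<in>M. d x y = s n"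
    "\<And>n. s (Suc n) < s n / 5" by metis
  define A where "A n = {y \<in> M. s n / 2 \<le> d x y \<and> d x y \<le> 2 * s n}" for n
  define T where "T n = {y \<in> M. s n / 2 < d x y \<and> d x y < 2 * s n}" for n
  define S where "S n = E closure_of (T n)" for n
  have "T n = mball x (2 * s n) - mcball x (s n / 2)" for n using x by (auto simp: T_def)
  then have T: "openin E (T n)" for n by (simp add: E openin_diff)
  have "A n = mcball x (2 * s n) - mball x (s n / 2)" for n using x by (auto simp: A_def)
  then have "closedin E (A n)" for n by (simp add: E closedin_diff)
  moreover have "T n \<subseteq> A n" for n by (auto simp: T_def A_def)
  ultimately have SA: "S n \<subseteq> A n" for n
    unfolding S_def by (meson closure_of_minimal)
  have OS: "T n \<subseteq> S n" for n
    unfolding S_def using T closure_of_subset openin_subset by metis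
  have dec: "s (n + k) \<le> s n / 5 ^ k" for n k
  proof (induction k)
    case (Suc k)
    have "s (n + Suc k) \<le> s (n + k) / 5" using s(4)[of "n + k"] by simp
    also have "\<dots> \<le> s n / 5 ^ k / 5" using Suc by (intro divide_right_mono) auto
    finally show ?case by (simp add: mult.commute)
  qed simp
  \<comment> \<open>Since \<open>s n \<le> s m / 5\<close>, the outer radius \<open>2 * s n\<close>
    is below the inner radius \<open>s m / 2\<close>.\<close>
  have disj: "A m \<inter> A n = {}" if mn: "m < n" for m n
  proof -
    obtain k where k: "n = m + Suc k" using mn less_iff_Suc_add[of m n] by auto
    have "(5::real) ^ Suc k \<ge> 5" by simp
    then have "s m / 5 ^ Suc k \<le> s m / 5" using s(1)[of m] by (intro divide_left_mono) auto
    then have "s n \<le> s m / 5" using dec[of m "Suc k"] k by simp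
    then show ?thesis using s(1)[of m] by (auto simp: A_def)
  qed
  show thesis
  proof
    show "closedin E (S n)" for n by (simp add: S_def)
    have "A n \<subseteq> mball x e" for n using s(2)[of n] x by (auto simp: A_def)
    then show "S n \<subseteq> N" for n using SA e(2) by blast
    have "x \<notin> A n" for n using s(1)[of n] x by (auto simp: A_def)
    then show "x \<notin> S n" for n using SA by blast
    obtain y where "\<And>n. y n \<in> M \<and> d x (y n) = s n" using s(3) by metis
    then have "y n \<in> T n" for n using s(1)[of n] by (simp add: T_def)
    then show "S n \<noteq> {}" for n using OS by blast
    have "T n \<subseteq> E interior_of S n" for n by (intro interior_of_maximal OS T)
    then show "S n \<subseteq> E closure_of (E interior_of S n)" for n
      by (metis S_def closure_of_mono)
    show "S m \<inter> S n = {}" if "m \<noteq> n" for m n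
      using disj[of m n] disj[of n m] SA[of m] SA[of n] that by (metis inf_commute inf_mono linorder_neqE_nat subset_empty)
    fix V assume V: "openin E V" "x \<in> V"
    obtain r where r: "r > 0" "mball x r \<subseteq> V" using V unfolding E openin_mtopology by blast
    obtain n where n: "(1 / 5) ^ n < r / (2 * s 0)"
      using real_arch_pow_inv[of "r / (2 * s 0)" "1 / 5"] r s(1)[of 0] by auto
    have "A m \<subseteq> mball x r" if "m \<ge> n" for m
    proof -
      have "s m \<le> s 0 * (1 / 5) ^ m" using dec[of 0 m] by (simp add: power_divide)
      also have "\<dots> \<le> s 0 * (1 / 5) ^ n"
        using that s(1)[of 0] by (intro mult_left_mono power_decreasing) auto
      also have "\<dots> < r / 2" using n s(1)[of 0] by (simp add: field_simps)
      finally show ?thesis using x by (auto simp: A_def)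
    qed
    then show "\<exists>n. \<forall>m\<ge>n. S m \<subseteq> V" using SA r(2) by blast
  qed
qed

text \<open>For a point outside the set only finitely many \<open>S j\<close> matter, because the
  others lie in a neighbourhood of \<open>x\<close> that is separated from that point.\<close>

lemma closedin_insert_limit_Union:
  assumes "Hausdorff_space E" "x \<in> topspace E" and S: "\<And>n. closedin E (S (n::nat))"
    and conv: "\<And>V. \<lbrakk>openin E V; x \<in> V\<rbrakk> \<Longrightarrow> \<exists>n. \<forall>m\<ge>n. S m \<subseteq> V"
  shows "closedin E (insert x (\<Union>j\<in>J. S j))"
  unfolding closedin_def
proof
  show "insert x (\<Union>j\<in>J. S j) \<subseteq> topspace E" using assms(2) closedin_subset[OF S] by blast
  show "openin E (topspace E - insert x (\<Union>j\<in>J. S j))"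
  proof (subst openin_subopen, intro ballI)
    fix z assume z: "z \<in> topspace E - insert x (\<Union>j\<in>J. S j)"
    then obtain V V' where V: "openin E V" "openin E V'" "x \<in> V" "z \<in> V'" "disjnt V V'"
      using assms(1,2) unfolding Hausdorff_space_def by (metis DiffE insertI1)
    obtain n where n: "\<forall>m\<ge>n. S m \<subseteq> V" using conv V by blast
    have "closedin E (\<Union>j\<in>J \<inter> {..<n}. S j)" using S by (intro closedin_Union) auto
    then have "openin E (V' - (\<Union>j\<in>J \<inter> {..<n}. S j))" using V(2) by blast
    moreover have "z \<in> V' - (\<Union>j\<in>J \<inter> {..<n}. S j)" using z V by blast
    moreover have "V' - (\<Union>j\<in>J \<inter> {..<n}. S j) \<subseteq> topspace E - insert x (\<Union>j\<in>J. S j)"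
    proof
      fix w assume w: "w \<in> V' - (\<Union>j\<in>J \<inter> {..<n}. S j)"
      then have "w \<notin> V" using V by (auto simp: disjnt_def)
      then have "w \<notin> S j" if "j \<in> J" for j using w n that \<open>w \<notin> V\<close> by (cases "j < n") (auto simp: not_less)
      then show "w \<in> topspace E - insert x (\<Union>j\<in>J. S j)"
        using w \<open>w \<notin> V\<close> V openin_subset by fastforce
    qed
    ultimately show "\<exists>T. openin E T \<and> z \<in> T \<and> T \<subseteq> topspace E - insert x (\<Union>j\<in>J. S j)" by blast
  qed
qed

text \<open>The closed upward closed hull of the traces of the members of \<open>W\<close> on \<open>L\<close>.\<close>
definition trace_hull :: "'a topology \<Rightarrow> 'a set set \<Rightarrow> 'a set \<Rightarrow> 'a set set" where
  "trace_hull E W L = {B \<in> compacts E. \<forall>U. openin E U \<and> B \<subseteq> U \<longrightarrow> (\<exists>C\<in>W. C \<inter> L \<subseteq> U)}"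

text \<open>An open set \<open>U\<close> that witnesses failure for \<open>B\<close> also witnesses
  it for every compact subset of \<open>U\<close>.\<close>

lemma closedin_trace_hull: "closedin (vietoris E) (trace_hull E W L)"
  unfolding closedin_def
proof
  show "trace_hull E W L \<subseteq> topspace (vietoris E)" by (auto simp: trace_hull_def)
  show "openin (vietoris E) (topspace (vietoris E) - trace_hull E W L)"
  proof (subst openin_subopen, intro ballI)
    fix B assume "B \<in> topspace (vietoris E) - trace_hull E W L"
    then obtain U where U: "B \<in> compacts E" "openin E U" "B \<subseteq> U" "\<not> (\<exists>C\<in>W. C \<inter> L \<subseteq> U)"
      by (auto simp: trace_hull_def)
    then show "\<exists>T. openin (vietoris E) T \<and> B \<in> T \<and> T \<subseteq> topspace (vietoris E) - trace_hull E W L"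
      by (intro exI[of _ "{K \<in> compacts E. K \<subseteq> U}"])
         (auto simp: openin_vietoris_subset trace_hull_def)
  qed
qed

lemma trace_hull_mono:
  "\<lbrakk>A \<in> trace_hull E W L; A \<subseteq> B; B \<in> compacts E\<rbrakk> \<Longrightarrow> B \<in> trace_hull E W L"
  by (auto simp: trace_hull_def)

lemma trace_hull_superset:
  "\<lbrakk>C \<in> W; C \<inter> L \<subseteq> B; B \<in> compacts E\<rbrakk> \<Longrightarrow> B \<in> trace_hull E W L"
  by (auto simp: trace_hull_def)

text \<open>Otherwise the complement of \<open>K\<close> would be an open set around
  \<open>B\<close> containing some trace.\<close>

lemma trace_hull_hits:
  assumes "closedin E K" "\<And>C. C \<in> W \<Longrightarrow> C \<inter> L \<inter> K \<noteq> {}" "B \<in> trace_hull E W L"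
  shows "B \<inter> K \<noteq> {}"
proof
  assume "B \<inter> K = {}"
  then have "B \<subseteq> topspace E - K"
    using assms(3) by (auto simp: trace_hull_def compacts_def dest: compactin_subset_topspace)
  moreover have "openin E (topspace E - K)" using assms(1) by blast
  ultimately obtain C where "C \<in> W" "C \<inter> L \<subseteq> topspace E - K"
    using assms(3) unfolding trace_hull_def by blast
  then show False using assms(2) by blast
qed

text \<open>For compact \<open>C\<close>, \<open>C \<inter> L \<subseteq> U\<close> is the open
  condition \<open>C \<subseteq> U \<union> (topspace E - L)\<close>. So the members of
  \<open>W \<inter> F\<close> satisfying it form a nonempty relatively open set, which cannot lie
  inside the meager set \<open>hits E K \<inter> F\<close>.\<close>

lemma trace_hull_avoid:
  assumes E: "compact_space E" "Hausdorff_space E" and F: "closedin (vietoris E) F"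
    and W: "openin (vietoris E) W" and L: "closedin E L" and K: "closedin E K"
    and meager: "meager_in (subtopology (vietoris E) F) (hits E K \<inter> F)"
    and B: "B \<in> trace_hull E (W \<inter> F) L" "openin E U" "B \<subseteq> U"
  obtains C where "C \<in> W \<inter> F" "C \<inter> L \<subseteq> U" "C \<inter> K = {}"
proof -
  have cF: "F \<subseteq> compacts E" using closedin_subset[OF F] by simp
  let ?N = "{C \<in> compacts E. C \<subseteq> U \<union> (topspace E - L)}"
  obtain C where C: "C \<in> W \<inter> F" "C \<inter> L \<subseteq> U" using B unfolding trace_hull_def by blast
  then have "C \<in> W \<inter> ?N \<inter> F"
    using cF by (auto simp: compacts_def dest: compactin_subset_topspace)
  moreover have "openin (vietoris E) (W \<inter> ?N)"
    using W B(2) L by (intro openin_Int openin_vietoris_subset openin_Un) auto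
  ultimately have "\<not> W \<inter> ?N \<inter> F \<subseteq> hits E K"
    using meager nonmeager_hits_iff[OF E F K] by blast
  then obtain D where "D \<in> W" "D \<in> ?N" "D \<in> F" "D \<notin> hits E K" by blast
  then show thesis by (intro that[of D]) (auto simp: hits_def)
qed

text \<open>Allows points of \<open>S\<close> to be chosen off \<open>K\<close>: an open set meeting
  \<open>S\<close> meets its interior in a nonempty open set, which \<open>K\<close> cannot
  contain.\<close>

lemma open_meets_fat_set:
  assumes "openin E U" "U \<inter> S \<noteq> {}" "S \<subseteq> E closure_of (E interior_of S)" "E interior_of K = {}"
  shows "\<exists>z. z \<in> U \<inter> S - K"
proof -
  have "U \<inter> E closure_of (E interior_of S) \<noteq> {}" using assms(2,3) by blast
  then have "U \<inter> E interior_of S \<noteq> {}"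
    using openin_Int_closure_of_eq_empty[OF assms(1)] by blast
  moreover have "openin E (U \<inter> E interior_of S)" using assms(1) by (simp add: openin_Int)
  ultimately have "\<not> U \<inter> E interior_of S \<subseteq> K"
    using assms(4) unfolding interior_of_eq_empty by blast
  then show ?thesis using interior_of_subset[of E S] by blast
qed

section \<open>The construction when there are two limit points\<close>

text \<open>For \<open>K\<close> with interior, both sides hold, by \<open>int\<close> and by upward
  closure. For \<open>K\<close> without interior, only the containment conditions
  \<open>C \<subseteq> U\<close> on \<open>F'\<close> have to be compared with
  \<open>F\<close>.\<close>

lemma exists_closed_upwards_two_limit_points:
  assumes E: "compact_space E" "metrizable_space E" "second_countable E"
    and F: "closedin (vietoris E) F" "F \<noteq> {}"
    and int: "\<And>K. \<lbrakk>closedin E K; E interior_of K \<noteq> {}\<rbrakk> \<Longrightarrow>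
      \<not> meager_in (subtopology (vietoris E) F) (hits E K \<inter> F)"
    and p: "p \<in> topspace E" "\<not> openin E {p}" and q: "q \<in> topspace E" "\<not> openin E {q}"
    and "p \<noteq> q"
  obtains F' where "closedin (vietoris E) F'" "closed_upwards E F'"
    "\<And>K. closedin E K \<Longrightarrow> \<not> meager_in (subtopology (vietoris E) F') (hits E K \<inter> F') \<longleftrightarrow>
      \<not> meager_in (subtopology (vietoris E) F) (hits E K \<inter> F)"
proof -
  have haus: "Hausdorff_space E" using E(2) by (rule metrizable_imp_Hausdorff_space)
  note com = compacts_eq_closedin[OF E(1) haus]
  \<comment> \<open>Indexing by \<open>bool\<close> treats the two limit points uniformly;
    \<open>\<not> i\<close> is the other one.\<close>
  define x where "x i = (if i then p else q)" for i :: bool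
  obtain Np Nq where Npq: "openin E Np" "openin E Nq" "p \<in> Np" "q \<in> Nq" "disjnt Np Nq"
    using haus p(1) q(1) \<open>p \<noteq> q\<close> unfolding Hausdorff_space_def by meson
  define N where "N i = (if i then Np else Nq)" for i :: bool
  have x: "x i \<in> topspace E" "\<not> openin E {x i}" for i using p q by (auto simp: x_def)
  have N: "openin E (N i)" "x i \<in> N i" for i using Npq by (auto simp: N_def x_def)
  have Ndisj: "N i \<inter> N (\<not> i) = {}" for i using Npq by (auto simp: N_def disjnt_def)
  have "\<exists>S :: nat \<Rightarrow> 'a set. (\<forall>n. closedin E (S n)) \<and> (\<forall>n. S n \<subseteq> N i) \<and> (\<forall>n. x i \<notin> S n) \<and>
      (\<forall>n. S n \<noteq> {}) \<and> (\<forall>n. S n \<subseteq> E closure_of (E interior_of S n)) \<and>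
      (\<forall>m n. m \<noteq> n \<longrightarrow> S m \<inter> S n = {}) \<and>
      (\<forall>V. openin E V \<and> x i \<in> V \<longrightarrow> (\<exists>n. \<forall>m\<ge>n. S m \<subseteq> V))" for i
    by (rule shells_converging_to_limit_point[OF E(2) x N, of i]) metis
  then obtain S :: "bool \<Rightarrow> nat \<Rightarrow> 'a set" where S: "\<And>i n. closedin E (S i n)"
    "\<And>i n. S i n \<subseteq> N i" "\<And>i n. x i \<notin> S i n" "\<And>i n. S i n \<noteq> {}"
    "\<And>i n. S i n \<subseteq> E closure_of (E interior_of S i n)"
    "\<And>i m n. m \<noteq> n \<Longrightarrow> S i m \<inter> S i n = {}"
    "\<And>i V. \<lbrakk>openin E V; x i \<in> V\<rbrakk> \<Longrightarrow> \<exists>n. \<forall>m\<ge>n. S i m \<subseteq> V"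
    by metis
  define Y where "Y i J = insert (x i) (\<Union>j\<in>J. S i j)" for i J
  have Y: "closedin E (Y i J)" for i J
    unfolding Y_def by (rule closedin_insert_limit_Union[OF haus x(1) S(1) S(7)])
  \<comment> \<open>The even shells make up \<open>X i\<close>; the odd ones remain to label the
    pieces \<open>Q m\<close>.\<close>
  define X where "X i = Y i (range ((*) 2))" for i
  have X: "closedin E (X i)" for i by (simp add: X_def Y)
  \<comment> \<open>At the added point \<open>x i\<close> this holds because the nonempty even
    shells converge to it.\<close>
  have Xfat: "X i \<subseteq> E closure_of (E interior_of X i)" for i
  proof
    fix z assume z: "z \<in> X i"
    have SX: "S i (2 * n) \<subseteq> E closure_of (E interior_of X i)" for n
    proof -
      have "S i (2 * n) \<subseteq> X i" by (auto simp: X_def Y_def)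
      then show ?thesis
        using S(5)[of i "2 * n"] by (meson closure_of_mono interior_of_mono subset_trans)
    qed
    show "z \<in> E closure_of (E interior_of X i)"
    proof (cases "z = x i")
      case True
      have "x i \<in> E closure_of (E closure_of (E interior_of X i))"
      proof (rule in_closure_of[THEN iffD2], intro conjI allI impI)
        fix V assume "x i \<in> V \<and> openin E V"
        then obtain n where "\<forall>m\<ge>n. S i m \<subseteq> V" using S(7) by blast
        then have "S i (2 * n) \<subseteq> V" by simp
        then show "\<exists>y. y \<in> E closure_of (E interior_of X i) \<and> y \<in> V"
          using S(4)[of i "2 * n"] SX by blast
      qed (rule x)
      then show ?thesis using True by simp
    next
      case False
      then show ?thesis using z SX by (auto simp: X_def Y_def)
    qed
  qed
  obtain \<B> where \<B>: "countable \<B>" "\<And>V. V \<in> \<B> \<Longrightarrow> openin (vietoris E) V"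
    "\<And>U x. \<lbrakk>openin (vietoris E) U; x \<in> U\<rbrakk> \<Longrightarrow> \<exists>V\<in>\<B>. x \<in> V \<and> V \<subseteq> U"
    using second_countable_vietoris[OF E(3)] unfolding second_countable_def by auto
  \<comment> \<open>The second component names the limit point near which traces are cut off. The
    enumeration \<open>e\<close> of these pairs may repeat; equal pairs are still told apart by
    their shells.\<close>
  define P where "P = {V \<in> \<B>. V \<inter> F \<noteq> {}} \<times> (UNIV :: bool set)"
  have "countable P" unfolding P_def using \<B>(1) by (intro countable_SIGMA) auto
  moreover have "P \<noteq> {}"
  proof -
    obtain A where A: "A \<in> F" using F(2) by blast
    then have "A \<in> topspace (vietoris E)" using closedin_subset[OF F(1)] by blast
    then obtain V where "V \<in> \<B>" "A \<in> V" using \<B>(3)[OF openin_topspace] by metis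
    then have "(V, True) \<in> P" using A by (auto simp: P_def)
    then show ?thesis by blast
  qed
  ultimately obtain e :: "nat \<Rightarrow> _" where e: "range e = P"
    using range_from_nat_into[of P] by blast
  define W where "W m = fst (e m)" for m :: nat
  \<comment> \<open>Traces on \<open>L i\<close> leave the whole neighbourhood \<open>N i\<close> of
    \<open>x i\<close> free for isolating a piece.\<close>
  define L where "L i = topspace E - N i" for i
  define G where "G m = trace_hull E (W m \<inter> F) (L (snd (e m)))" for m
  have "W m \<in> {V \<in> \<B>. V \<inter> F \<noteq> {}}" for m
    using rangeI[of e m] unfolding e P_def by (auto simp: W_def)
  then have W: "openin (vietoris E) (W m)" for m
    using \<B>(2) by blast
  have L: "closedin E (L i)" for i using N(1)[of i] by (simp add: L_def closedin_diff)
  define Q where "Q m = G m \<inter> (\<Inter>i. hits E (S i (2 * m + 1)))" for m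
  define F' where "F' = (\<Inter>i. hits E (X i)) \<union> (\<Union>m. Q m)"
  have Q: "closedin (vietoris E) (Q m)" for m
    unfolding Q_def G_def
    by (intro closedin_Int closedin_Inter closedin_trace_hull) (auto intro!: closedin_vietoris_hits S)
  have closedF': "closedin (vietoris E) F'"
  proof -
    \<comment> \<open>\<open>T n i\<close> adds to \<open>X i\<close> all shells from index
      \<open>n\<close> on. Members of the pieces with \<open>m \<ge> n\<close> hit both sets
      \<open>T n i\<close>, so at each stage only finitely many pieces must be listed
      separately.\<close>
    define T where "T n i = Y i (range ((*) 2) \<union> {n..})" for n i
    have "F' = (\<Inter>n. (\<Inter>i. hits E (T n i)) \<union> (\<Union>m\<in>{..<n}. Q m))" (is "_ = ?R")
    proof (intro equalityI subsetI)
      fix B assume B: "B \<in> F'"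
      have "X i \<subseteq> T n i" for n i by (auto simp: X_def T_def Y_def)
      then have XT: "hits E (X i) \<subseteq> hits E (T n i)" for n i unfolding hits_def by blast
      have "S i (2 * m + 1) \<subseteq> T n i" if "n \<le> m" for n m i
        using that by (auto simp: T_def Y_def)
      then have ST: "hits E (S i (2 * m + 1)) \<subseteq> hits E (T n i)" if "n \<le> m" for n m i
        using that unfolding hits_def by blast
      have "B \<in> (\<Inter>i. hits E (T n i)) \<union> (\<Union>m\<in>{..<n}. Q m)" for n
      proof (cases "\<exists>m<n. B \<in> Q m")
        case False
        then consider "\<And>i. B \<in> hits E (X i)" | m where "n \<le> m" "B \<in> Q m"
          using B unfolding F'_def by (auto simp: not_less)
        then show ?thesis
        proof cases
          case 1
          then show ?thesis using XT by blast
        next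
          case 2
          then have "B \<in> hits E (S i (2 * m + 1))" for i by (auto simp: Q_def)
          then show ?thesis using ST[OF 2(1)] by blast
        qed
      qed blast
      then show "B \<in> ?R" by blast
    next
      fix B assume B: "B \<in> ?R"
      show "B \<in> F'"
      proof (cases "\<exists>m. B \<in> Q m")
        case False
        then have hit: "B \<in> hits E (T n i)" for n i using B by blast
        then have "B \<in> compacts E" by (auto simp: hits_def)
        have "B \<inter> X i \<noteq> {}" for i
        proof
          \<comment> \<open>A closed set missing \<open>x i\<close> misses all late shells, so
            \<open>B\<close> would miss \<open>T n i\<close> for some large
            \<open>n\<close>.\<close>
          assume "B \<inter> X i = {}"
          then have "x i \<in> topspace E - B" using x by (auto simp: X_def Y_def)
          moreover have "openin E (topspace E - B)"
            using \<open>B \<in> compacts E\<close> com by auto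
          ultimately obtain n where "\<forall>m\<ge>n. S i m \<subseteq> topspace E - B" using S(7) by blast
          then have "B \<inter> T n i = {}"
            using \<open>B \<inter> X i = {}\<close> by (auto simp: T_def X_def Y_def)
          then show False using hit by (auto simp: hits_def)
        qed
        then show ?thesis using \<open>B \<in> compacts E\<close> by (auto simp: F'_def hits_def)
      qed (auto simp: F'_def)
    qed
    moreover have "closedin (vietoris E) ?R"
      using Q Y unfolding T_def
      by (intro closedin_Inter) (auto intro!: closedin_Un closedin_Inter closedin_Union closedin_vietoris_hits)
    ultimately show ?thesis by simp
  qed
  have upF': "closed_upwards E F'"
    unfolding closed_upwards_def
  proof (intro ballI impI)
    fix A B assume AB: "A \<in> compacts E" "B \<in> compacts E" "A \<in> F' \<and> A \<subseteq> B"
    then have hits: "A \<in> hits E Z \<Longrightarrow> B \<in> hits E Z" for Z unfolding hits_def by blast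
    have "A \<in> G m \<Longrightarrow> B \<in> G m" for m unfolding G_def using AB by (blast intro: trace_hull_mono)
    then have "A \<in> Q m \<Longrightarrow> B \<in> Q m" for m unfolding Q_def using hits by blast
    then show "B \<in> F'" using AB(3) hits unfolding F'_def by blast
  qed
  have topF': "topspace E \<in> F'"
  proof -
    have "topspace E \<inter> X i \<noteq> {}" for i using x by (auto simp: X_def Y_def)
    then show ?thesis using com by (auto simp: F'_def hits_def)
  qed
  show thesis
  proof
    show "closedin (vietoris E) F'" "closed_upwards E F'" by fact+
    fix K assume K: "closedin E K"
    show "\<not> meager_in (subtopology (vietoris E) F') (hits E K \<inter> F') \<longleftrightarrow>
      \<not> meager_in (subtopology (vietoris E) F) (hits E K \<inter> F)" (is "?L \<longleftrightarrow> ?R")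
    proof (cases "E interior_of K = {}")
      case False
      then show ?thesis
        using int[OF K] nonmeager_hits_if_interior[OF E(1) haus closedF' upF' _ K] topF' by blast
    next
      case True
      note char = nonmeager_hits_closed_upwards_iff[OF E(1) haus closedF' upF' K True]
      show ?thesis
      proof
        assume ?R
        \<comment> \<open>Every point lies outside one of the two disjoint neighbourhoods, so at
          least one of the parts \<open>K \<inter> L i\<close> is not small.\<close>
        have "L True \<union> L False = topspace E" using Ndisj[of True] by (auto simp: L_def)
        then have "hits E K \<inter> F \<subseteq> (hits E (K \<inter> L True) \<inter> F) \<union> (hits E (K \<inter> L False) \<inter> F)"
          using closedin_subset[OF K] by (auto simp: hits_def)
        then obtain i where i: "\<not> meager_in (subtopology (vietoris E) F) (hits E (K \<inter> L i) \<inter> F)"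
          using \<open>?R\<close> meager_in_Un meager_in_subset by metis
        obtain W0 where W0: "openin (vietoris E) W0" "W0 \<inter> F \<noteq> {}" "W0 \<inter> F \<subseteq> hits E (K \<inter> L i)"
          using i nonmeager_hits_iff[OF E(1) haus F(1) closedin_Int[OF K L]] by blast
        then obtain V where V: "V \<in> \<B>" "V \<inter> F \<noteq> {}" "V \<subseteq> W0" using \<B>(3) by blast
        then have "(V, i) \<in> range e" by (simp add: e P_def)
        then obtain m where m: "e m = (V, i)" by (metis rangeE)
        \<comment> \<open>Removing \<open>x i\<close> and all its shells except the one with index
          \<open>2 * m + 1\<close> excludes the sets meeting both \<open>X j\<close> and every piece
          other than \<open>Q m\<close>.\<close>
        define U where "U = topspace E - Y i (- {2 * m + 1})"
        have "openin E U" using Y by (auto simp: U_def)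
        moreover have "\<exists>C\<in>F'. C \<subseteq> U"
        proof
          \<comment> \<open>\<open>L i\<close> contains every trace on it and also the shell of the
            other limit point, so only one shell at \<open>x i\<close> has to be added.\<close>
          let ?C = "L i \<union> S i (2 * m + 1)"
          have C: "?C \<in> compacts E" using L S(1) com by auto
          obtain A where "A \<in> V \<inter> F" using V by blast
          then have "?C \<in> G m"
            unfolding G_def using C m by (intro trace_hull_superset[of A]) (auto simp: W_def)
          moreover have "?C \<inter> S j (2 * m + 1) \<noteq> {}" for j
          proof (cases "j = i")
            case True then show ?thesis using S(4) by blast
          next
            case False
            then have "j = (\<not> i)" by blast
            then have "S j (2 * m + 1) \<subseteq> L i"
              using S(2)[of j "2 * m + 1"] Ndisj[of i] closedin_subset[OF S(1)[of j "2 * m + 1"]]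
              by (auto simp: L_def)
            then show ?thesis using S(4)[of j "2 * m + 1"] by blast
          qed
          ultimately show "?C \<in> F'" using C unfolding F'_def Q_def hits_def by blast
          have "Y i (- {2 * m + 1}) \<subseteq> N i" using N(2) S(2) unfolding Y_def by blast
          moreover have "S i (2 * m + 1) \<inter> S i j = {}" if "j \<in> - {2 * m + 1}" for j
            using S(6)[of "2 * m + 1" j i] that by blast
          then have "S i (2 * m + 1) \<inter> Y i (- {2 * m + 1}) = {}"
            using S(3) unfolding Y_def by blast
          ultimately show "?C \<subseteq> U"
            using closedin_subset[OF S(1)[of i "2 * m + 1"]] by (auto simp: U_def L_def)
        qed
        moreover have "C \<inter> K \<noteq> {}" if C: "C \<in> F'" "C \<subseteq> U" for C
        proof -
          have "C \<notin> hits E (X i)"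
          proof -
            have "range ((*) 2) \<subseteq> - {2 * m + 1}" by auto presburger
            then have "X i \<subseteq> Y i (- {2 * m + 1})" unfolding X_def Y_def by blast
            then show ?thesis using C(2) by (auto simp: U_def hits_def)
          qed
          then obtain k where k: "C \<in> Q k" using C(1) unfolding F'_def by blast
          have "k = m"
          proof (rule ccontr)
            assume "k \<noteq> m"
            then have "S i (2 * k + 1) \<subseteq> Y i (- {2 * m + 1})" by (auto simp: Y_def)
            moreover have "C \<inter> S i (2 * k + 1) \<noteq> {}" using k by (auto simp: Q_def hits_def)
            ultimately show False using C(2) by (auto simp: U_def)
          qed
          then have "C \<in> trace_hull E (V \<inter> F) (L i)" using k m by (simp add: Q_def G_def W_def)
          moreover have "A \<inter> L i \<inter> K \<noteq> {}" if "A \<in> V \<inter> F" for A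
            using that V(3) W0(3) by (auto simp: hits_def)
          ultimately show ?thesis using trace_hull_hits[OF K] by blast
        qed
        ultimately show ?L unfolding char by blast
      next
        assume ?L
        then obtain U C where U: "openin E U" "C \<in> F'" "C \<subseteq> U"
          and "\<forall>C\<in>F'. C \<subseteq> U \<longrightarrow> C \<inter> K \<noteq> {}" unfolding char by (elim exE bexE conjE)
        then have meet: "C \<inter> K \<noteq> {}" if "C \<in> F'" "C \<subseteq> U" for C using that by blast
        show ?R
        proof
          \<comment> \<open>If \<open>K\<close> is small, the member \<open>C\<close> of
            \<open>F'\<close> inside \<open>U\<close> can be replaced by one that also misses
            \<open>K\<close>, contradicting \<open>meet\<close>.\<close>
          assume meager: "meager_in (subtopology (vietoris E) F) (hits E K \<inter> F)"
          have fin: "closedin E (range z)" if "\<And>i. z i \<in> U" for z :: "bool \<Rightarrow> 'a"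
            using that openin_subset[OF U(1)] haus
            by (intro closedin_Hausdorff_finite) auto
          consider "\<And>i. C \<in> hits E (X i)" | m where "C \<in> Q m" using U(2) unfolding F'_def by blast
          then show False
          proof cases
            case 1
            then have "U \<inter> X i \<noteq> {}" for i using U(3) by (auto simp: hits_def)
            then have "\<exists>z. z \<in> U \<inter> X i - K" for i
              using open_meets_fat_set[OF U(1) _ Xfat True] by blast
            \<comment> \<open>One point off \<open>K\<close> in each \<open>X i\<close> is enough:
              these points already form a member of \<open>F'\<close>.\<close>
            then obtain z where z: "\<And>i. z i \<in> U \<inter> X i - K" by metis
            then have "range z \<in> compacts E" using fin com by auto
            moreover have "range z \<inter> X i \<noteq> {}" for i using z by blast
            ultimately have "range z \<in> F'" by (auto simp: F'_def hits_def)
            then show False using meet[of "range z"] z by blast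
          next
            case 2
            then have "U \<inter> S i (2 * m + 1) \<noteq> {}" for i using U(3) by (auto simp: Q_def hits_def)
            then have "\<exists>z. z \<in> U \<inter> S i (2 * m + 1) - K" for i
              using open_meets_fat_set[OF U(1) _ S(5) True] by blast
            then obtain z where z: "\<And>i. z i \<in> U \<inter> S i (2 * m + 1) - K" by metis
            have "C \<in> trace_hull E (W m \<inter> F) (L (snd (e m)))"
              using 2 by (simp add: Q_def G_def)
            then obtain D where D: "D \<in> W m \<inter> F" "D \<inter> L (snd (e m)) \<subseteq> U" "D \<inter> K = {}"
              using trace_hull_avoid[OF E(1) haus F(1) W L K meager _ U(1,3)] by blast
            \<comment> \<open>\<open>D\<close> supplies a trace that misses \<open>K\<close>, and
              \<open>range z\<close> restores the hits with both shells without touching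
              \<open>K\<close>.\<close>
            let ?D = "D \<inter> L (snd (e m)) \<union> range z"
            have "closedin E D" using D(1) closedin_subset[OF F(1)] com by auto
            then have comD: "?D \<in> compacts E" using fin[of z] z L com by auto
            moreover have "?D \<in> G m"
              unfolding G_def using D(1) comD by (intro trace_hull_superset[of D]) auto
            moreover have "?D \<inter> S i (2 * m + 1) \<noteq> {}" for i using z by blast
            ultimately have "?D \<in> Q m" by (auto simp: Q_def hits_def)
            then have "?D \<in> F'" by (auto simp: F'_def)
            moreover have "?D \<subseteq> U" using D z by blast
            ultimately have "?D \<inter> K \<noteq> {}" by (rule meet)
            then show False using D(3) z by blast
          qed
        qed
      qed
    qed
  qed
qed

section \<open>The construction with at most one limit point\<close>

text \<open>A nonempty set without interior can then only be the singleton of the limit point, and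
  by \<open>int\<close> no other nonempty closed set can be small. If no nonempty closed set is
  small, \<open>{topspace E}\<close> works; otherwise the family of all nonempty compact sets
  does.\<close>

lemma exists_closed_upwards_one_limit_point:
  assumes E: "compact_space E" "Hausdorff_space E"
    and F: "closedin (vietoris E) F"
    and int: "\<And>K. \<lbrakk>closedin E K; E interior_of K \<noteq> {}\<rbrakk> \<Longrightarrow>
      \<not> meager_in (subtopology (vietoris E) F) (hits E K \<inter> F)"
    and single: "\<And>p q. \<lbrakk>p \<in> topspace E; \<not> openin E {p}; q \<in> topspace E; \<not> openin E {q}\<rbrakk> \<Longrightarrow> p = q"
  obtains F' where "closedin (vietoris E) F'" "closed_upwards E F'"
    "\<And>K. closedin E K \<Longrightarrow> \<not> meager_in (subtopology (vietoris E) F') (hits E K \<inter> F') \<longleftrightarrow>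
      \<not> meager_in (subtopology (vietoris E) F) (hits E K \<inter> F)"
proof -
  note com = compacts_eq_closedin[OF E]
  let ?m = "\<lambda>F K. meager_in (subtopology (vietoris E) F) (hits E K \<inter> F)"
  have m_empty: "?m F {}" for F by (auto simp: hits_def meager_in_def)
  have isolated: "\<not> openin E {x}" if "x \<in> K" "E interior_of K = {}" for x K
    using that unfolding interior_of_eq_empty by blast
  show thesis
  proof (cases "\<exists>K0. closedin E K0 \<and> K0 \<noteq> {} \<and> ?m F K0")
    case False
    show thesis
    proof
      have top: "topspace E \<in> compacts E" using com by auto
      show cl: "closedin (vietoris E) {topspace E}"
        using top Hausdorff_space_vietoris[OF E(2)] by (intro closedin_Hausdorff_singleton) auto
      show "closed_upwards E {topspace E}"
        unfolding closed_upwards_def com using closedin_subset by blast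
      fix K assume K: "closedin E K"
      show "\<not> ?m {topspace E} K \<longleftrightarrow> \<not> ?m F K"
      proof (cases "K = {}")
        case True then show ?thesis using m_empty by simp
      next
        case ne: False
        then have "topspace E \<in> hits E K" using K closedin_subset top by (fastforce simp: hits_def)
        then have "\<not> ?m {topspace E} K"
          unfolding nonmeager_hits_iff[OF E cl K] using top
          by (intro exI[of _ "topspace (vietoris E)"] conjI openin_topspace) auto
        then show ?thesis using False K ne by blast
      qed
    qed
  next
    case True
    then obtain K0 where K0: "closedin E K0" "K0 \<noteq> {}" "?m F K0" by blast
    then have "E interior_of K0 = {}" using int by blast
    let ?F' = "compacts E - {{}}"
    show thesis
    proof
      \<comment> \<open>The empty set is an isolated point of the hyperspace, so removing it leaves
        a closed family.\<close>
      have "{K \<in> compacts E. K \<subseteq> {}} = {{}}" by (auto simp: com)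
      then have "openin (vietoris E) {{}}" using openin_vietoris_subset[of E "{}"] by simp
      then show cl: "closedin (vietoris E) ?F'" by (metis closedin_diff closedin_topspace topspace_vietoris)
      show up: "closed_upwards E ?F'" by (auto simp: closed_upwards_def)
      fix K assume K: "closedin E K"
      show "\<not> ?m ?F' K \<longleftrightarrow> \<not> ?m F K"
      proof (cases "E interior_of K = {}")
        case False
        moreover have "K0 \<in> ?F'" using K0 com by auto
        ultimately show ?thesis
          using nonmeager_hits_if_interior[OF E cl up _ K] int[OF K] by blast
      next
        case True
        \<comment> \<open>Both sets consist of nonisolated points, and there is at most one such
          point.\<close>
        have "K \<subseteq> K0"
        proof
          fix k assume k: "k \<in> K"
          obtain p where p: "p \<in> K0" using K0 by blast
          have "k \<in> topspace E" "p \<in> topspace E"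
            using k p closedin_subset[OF K] closedin_subset[OF K0(1)] by blast+
          then have "k = p"
            using single isolated[OF k True] isolated[OF p \<open>E interior_of K0 = {}\<close>] by simp
          then show "k \<in> K0" using p by simp
        qed
        then have "hits E K \<inter> F \<subseteq> hits E K0 \<inter> F" by (auto simp: hits_def)
        then have "?m F K" using K0(3) meager_in_subset by blast
        moreover have "?m ?F' K"
        proof (rule ccontr)
          assume "\<not> ?m ?F' K"
          then obtain U where U: "openin E U" "\<exists>C\<in>?F'. C \<subseteq> U"
            "\<forall>C\<in>?F'. C \<subseteq> U \<longrightarrow> C \<inter> K \<noteq> {}"
            unfolding nonmeager_hits_closed_upwards_iff[OF E cl up K True] by (elim exE conjE)
          have "U \<noteq> {}" using U(2) by auto
          then have "\<not> U \<subseteq> K" using True U(1) unfolding interior_of_eq_empty by blast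
          \<comment> \<open>The singleton of a point of \<open>U\<close> off \<open>K\<close> is a
            member of the family that misses \<open>K\<close>.\<close>
          then obtain u where u: "u \<in> U" "u \<notin> K" by blast
          then have "{u} \<in> ?F'" using openin_subset[OF U(1)] E(2) com
            by (auto intro: closedin_Hausdorff_singleton)
          then show False using U(3) u by (auto dest: bspec[of _ _ "{u}"])
        qed
        ultimately show ?thesis by blast
      qed
    qed
  qed
qed

(* The assumption nondegenerate excludes only the cases F = {} and F = {{}} over a nonempty E,
   where the equivalence is false: (1) fails for K = E, while (2) holds with F' = {}. *)
theorem theorem2:
  fixes E :: "'a topology" and F :: "'a set set"
  assumes polish: "polish_top E"
    and compact: "compact_space E"
    and closed: "closedin (vietoris E) F"
    and nondegenerate: "topspace E \<noteq> {} \<Longrightarrow> \<not> F \<subseteq> {{}}"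
  shows "(\<forall>K \<in> compacts E. E interior_of K \<noteq> {} \<longrightarrow>
            \<not> meager_in (subtopology (vietoris E) F) (hits E K \<inter> F))
     \<longleftrightarrow>
         (\<exists>F'. closedin (vietoris E) F' \<and> closed_upwards E F' \<and>
            (\<forall>K \<in> compacts E.
               \<not> meager_in (subtopology (vietoris E) F') (hits E K \<inter> F') \<longleftrightarrow>
               \<not> meager_in (subtopology (vietoris E) F) (hits E K \<inter> F)))"
  (is "?L \<longleftrightarrow> ?R")
proof
  have metr: "metrizable_space E"
    using polish by (simp add: polish_top_def completely_metrizable_imp_metrizable_space)
  then have haus: "Hausdorff_space E" by (rule metrizable_imp_Hausdorff_space)
  have sc: "second_countable E"
    using polish metr by (simp add: polish_top_def separable_metrizable_imp_second_countable)
  note com = compacts_eq_closedin[OF compact haus]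
  {
    assume ?L
    then have int: "\<not> meager_in (subtopology (vietoris E) F) (hits E K \<inter> F)"
      if "closedin E K" "E interior_of K \<noteq> {}" for K using that com by blast
    show ?R
    proof (cases "\<exists>p q. p \<in> topspace E \<and> \<not> openin E {p} \<and> q \<in> topspace E \<and> \<not> openin E {q} \<and> p \<noteq> q")
      case True
      then obtain p q where pq: "p \<in> topspace E" "\<not> openin E {p}" "q \<in> topspace E" "\<not> openin E {q}" "p \<noteq> q"
        by blast
      then have "F \<noteq> {}" using nondegenerate by blast
      then obtain F' where "closedin (vietoris E) F'" "closed_upwards E F'"
        "\<And>K. closedin E K \<Longrightarrow> \<not> meager_in (subtopology (vietoris E) F') (hits E K \<inter> F') \<longleftrightarrow>
          \<not> meager_in (subtopology (vietoris E) F) (hits E K \<inter> F)"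
        by (rule exists_closed_upwards_two_limit_points[OF compact metr sc closed _ int pq]) simp_all
      then show ?R unfolding com by (intro exI[of _ F']) simp
    next
      case False
      then have single: "p = q" if "p \<in> topspace E" "\<not> openin E {p}" "q \<in> topspace E" "\<not> openin E {q}" for p q
        using that by blast
      obtain F' where "closedin (vietoris E) F'" "closed_upwards E F'"
        "\<And>K. closedin E K \<Longrightarrow> \<not> meager_in (subtopology (vietoris E) F') (hits E K \<inter> F') \<longleftrightarrow>
          \<not> meager_in (subtopology (vietoris E) F) (hits E K \<inter> F)"
        by (rule exists_closed_upwards_one_limit_point[OF compact haus closed int single]) (assumption | rule that)+
      then show ?R unfolding com by (intro exI[of _ F']) simp
    qed
  }
  {
    assume ?R
    then obtain F' where F': "closedin (vietoris E) F'" "closed_upwards E F'"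
      "\<And>K. closedin E K \<Longrightarrow> \<not> meager_in (subtopology (vietoris E) F') (hits E K \<inter> F') \<longleftrightarrow>
        \<not> meager_in (subtopology (vietoris E) F) (hits E K \<inter> F)"
      unfolding com by auto
    show ?L
    proof (intro ballI impI)
      fix K assume "K \<in> compacts E" and K: "E interior_of K \<noteq> {}"
      then have "closedin E K" by (simp add: com)
      have "topspace E \<noteq> {}" using K interior_of_subset_topspace[of E K] by blast
      have FC: "F \<subseteq> compacts E" using closedin_subset[OF closed] by simp
      have "\<not> F \<subseteq> {{}}" using \<open>topspace E \<noteq> {}\<close> by (rule nondegenerate)
      \<comment> \<open>A nonempty member of \<open>F\<close> makes
        \<open>hits E (topspace E)\<close> nonmeager in \<open>F\<close>, hence in
        \<open>F'\<close>, so \<open>F'\<close> cannot be empty. The member \<open>{}\<close> would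
        not do, since it hits nothing.\<close>
      then obtain A where "A \<in> F" "A \<noteq> {}" by blast
      moreover have "A \<subseteq> topspace E" using FC \<open>A \<in> F\<close> closedin_subset by (auto simp: com)
      ultimately have "hits E (topspace E) \<inter> F \<noteq> {}" using FC by (auto simp: hits_def)
      then have "\<not> meager_in (subtopology (vietoris E) F) (hits E (topspace E) \<inter> F)"
        unfolding nonmeager_hits_iff[OF compact haus closed closedin_topspace]
        by (intro exI[of _ "hits E (topspace E)"]) (auto intro: openin_vietoris_hits)
      then have "\<not> meager_in (subtopology (vietoris E) F') (hits E (topspace E) \<inter> F')"
        using F'(3) by blast
      then have "F' \<noteq> {}" by (auto simp: meager_in_def)
      then have "\<not> meager_in (subtopology (vietoris E) F') (hits E K \<inter> F')"
        using nonmeager_hits_if_interior[OF compact haus F'(1,2) _ \<open>closedin E K\<close> K] by blast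
      then show "\<not> meager_in (subtopology (vietoris E) F) (hits E K \<inter> F)"
        using F'(3) \<open>closedin E K\<close> by blast
    qed
  }
qed

end
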